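(* Let $Q$ be the Cantor set with a compatible metric $d$. (1) A generic autonomous system on $Q$ is not distributionally chaotic: the set of maps $f\in C(Q)$ that are not distributionally chaotic (of any of the types 1, 2, 3) is residual in $(C(Q),\rho_{\sup})$. (2) A generic convergent non-autonomous system on $Q$ is not distributionally chaotic: the set of systems $f_{1,\infty}\in\mathcal{F}_p(Q)$ that are not distributionally chaotic (of any of the types 1, 2, 3) is residual in $(\mathcal{F}_p(Q),\rho_{\mathcal F})$.
   Context: $C(Q)$ is the set of continuous maps $Q\to Q$, with $\rho_{\sup}(f,g)=\sup_{x\in Q}d(f(x),g(x))$. A non-autonomous system on $Q$ is a sequence $f_{1,\infty}=\{f_n\}_{n=1}^\infty$ of continuous surjective maps $f_n:Q\to Q$. Its iterates are $f_{1,\infty}^0=\mathrm{id}$ and $f_{1,\infty}^n=f_n\circ\cdots\circ f_1$. An autonomous system $f\in C(Q)$ is treated in the same way with all $f_n=f$, so its iterates are $f^n$. $\mathcal{F}_p(Q)$ is the set of non-autonomous systems convergent in $\rho_{\sup}$, i.e. $\rho_{\sup}(f_n,f)\to0$ for some map $f$. It is equipped with $\rho_{\mathcal F}(f_{1,\infty},g_{1,\infty})=\sup_{n}\rho_{\sup}(f_n,g_n)$. A set is residual if it is the complement of a countable union of nowhere dense sets. For points $x,y$ and $t>0$ put $$\psi_{xy}(t)=\liminf_{n\to\infty}\tfrac1n\#\{0\le j<n: d(f_{1,\infty}^j(x),f_{1,\infty}^j(y))<t\},$$ $$\psi^*_{xy}(t)=\limsup_{n\to\infty}\tfrac1n\#\{0\le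 j<n: d(f_{1,\infty}^j(x),f_{1,\infty}^j(y))<t\}.$$ A pair $x,y$ is DC1-scrambled if $\psi^*_{xy}\equiv1$ and $\psi_{xy}(t)=0$ for some $t>0$. It is DC2-scrambled if $\psi^*_{xy}\equiv1$ and $\psi_{xy}(t)<\psi^*_{xy}(t)$ for some $t>0$. It is DC3-scrambled if $\psi_{xy}(t)<\psi^*_{xy}(t)$ for all $t$ in some interval of positive length. The system is distributionally chaotic of type $i$ ($i=1,2,3$) if there is an uncountable set all of whose pairs of distinct points are DC$i$-scrambled. *)

theory Defs
  imports "HOL-Analysis.Analysis"
begin

section \<open>The Cantor set\<close>

primrec cantor_stage :: "nat \<Rightarrow> real set" where
  "cantor_stage 0 = {0..1}"
| "cantor_stage (Suc n) =
     (\<lambda>x. x / 3) ` cantor_stage n \<union> (\<lambda>x. 2 / 3 + x / 3) ` cantor_stage n"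

definition cantor_set :: "real set" where
  "cantor_set = (\<Inter>n. cantor_stage n)"

section \<open>Residual sets\<close>

definition nowhere_dense_in :: "'a topology \<Rightarrow> 'a set \<Rightarrow> bool" where
  "nowhere_dense_in X A \<longleftrightarrow>
     A \<subseteq> topspace X \<and> X interior_of (X closure_of A) = {}"

definition residual_in :: "'a topology \<Rightarrow> 'a set \<Rightarrow> bool" where
  "residual_in X S \<longleftrightarrow> S \<subseteq> topspace X \<and>
     (\<exists>\<N>. countable \<N> \<and> (\<forall>A\<in>\<N>. nowhere_dense_in X A) \<and> topspace X - S = \<Union>\<N>)"

section \<open>Spaces of autonomous and non-autonomous systems\<close>

text \<open>The space \<open>Q\<close> is the universe of a type of class \<open>metric_space\<close>. The two suprema below
  are of bounded sets only if that universe is bounded, as it is when it is compact.\<close>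

definition rho_sup :: "('a::metric_space \<Rightarrow> 'a) \<Rightarrow> ('a \<Rightarrow> 'a) \<Rightarrow> real" where
  "rho_sup f g = (SUP x. dist (f x) (g x))"

definition cont_maps :: "('a::metric_space \<Rightarrow> 'a) set" where
  "cont_maps = {f. continuous_on UNIV f}"

definition cont_maps_topology :: "('a::metric_space \<Rightarrow> 'a) topology" where
  "cont_maps_topology = Metric_space.mtopology cont_maps rho_sup"

text \<open>Sequences are indexed from 0: the map \<open>F n\<close> is the one usually written with index
  \<open>n + 1\<close>, so \<open>F 0\<close> is applied first.\<close>

definition conv_systems :: "(nat \<Rightarrow> 'a::metric_space \<Rightarrow> 'a) set" where
  "conv_systems = {F. (\<forall>n. continuous_on UNIV (F n) \<and> surj (F n)) \<and>
     (\<exists>f. (\<lambda>n. rho_sup (F n) f) \<longlonglongrightarrow> 0)}"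

definition rho_F :: "(nat \<Rightarrow> 'a::metric_space \<Rightarrow> 'a) \<Rightarrow> (nat \<Rightarrow> 'a \<Rightarrow> 'a) \<Rightarrow> real" where
  "rho_F F G = (SUP n. rho_sup (F n) (G n))"

definition conv_systems_topology :: "(nat \<Rightarrow> 'a::metric_space \<Rightarrow> 'a) topology" where
  "conv_systems_topology = Metric_space.mtopology conv_systems rho_F"

primrec iterate :: "(nat \<Rightarrow> 'a \<Rightarrow> 'a) \<Rightarrow> nat \<Rightarrow> 'a \<Rightarrow> 'a" where
  "iterate F 0 = id"
| "iterate F (Suc n) = F n \<circ> iterate F n"

section \<open>Distributional chaos\<close>

definition close_freq ::
    "(nat \<Rightarrow> 'a::metric_space \<Rightarrow> 'a) \<Rightarrow> 'a \<Rightarrow> 'a \<Rightarrow> real \<Rightarrow> nat \<Rightarrow> real" where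
  "close_freq F x y t n =
     real (card {j. j < n \<and> dist (iterate F j x) (iterate F j y) < t}) / real n"

text \<open>The values are taken in \<open>ereal\<close> only because \<open>liminf\<close> and \<open>limsup\<close> live in a complete
  lattice; they always lie between 0 and 1.\<close>

definition lower_dist ::
    "(nat \<Rightarrow> 'a::metric_space \<Rightarrow> 'a) \<Rightarrow> 'a \<Rightarrow> 'a \<Rightarrow> real \<Rightarrow> ereal" where
  "lower_dist F x y t = liminf (\<lambda>n. ereal (close_freq F x y t n))"

definition upper_dist ::
    "(nat \<Rightarrow> 'a::metric_space \<Rightarrow> 'a) \<Rightarrow> 'a \<Rightarrow> 'a \<Rightarrow> real \<Rightarrow> ereal" where
  "upper_dist F x y t = limsup (\<lambda>n. ereal (close_freq F x y t n))"

definition DC1_scrambled :: "(nat \<Rightarrow> 'a::metric_space \<Rightarrow> 'a) \<Rightarrow> 'a \<Rightarrow> 'a \<Rightarrow> bool" where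
  "DC1_scrambled F x y \<longleftrightarrow>
     (\<forall>t>0. upper_dist F x y t = 1) \<and> (\<exists>t>0. lower_dist F x y t = 0)"

definition DC2_scrambled :: "(nat \<Rightarrow> 'a::metric_space \<Rightarrow> 'a) \<Rightarrow> 'a \<Rightarrow> 'a \<Rightarrow> bool" where
  "DC2_scrambled F x y \<longleftrightarrow>
     (\<forall>t>0. upper_dist F x y t = 1) \<and> (\<exists>t>0. lower_dist F x y t < upper_dist F x y t)"

definition DC3_scrambled :: "(nat \<Rightarrow> 'a::metric_space \<Rightarrow> 'a) \<Rightarrow> 'a \<Rightarrow> 'a \<Rightarrow> bool" where
  "DC3_scrambled F x y \<longleftrightarrow>
     (\<exists>a b. 0 \<le> a \<and> a < b \<and> (\<forall>t\<in>{a<..<b}. lower_dist F x y t < upper_dist F x y t))"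

definition DC1 :: "(nat \<Rightarrow> 'a::metric_space \<Rightarrow> 'a) \<Rightarrow> bool" where
  "DC1 F \<longleftrightarrow> (\<exists>S. uncountable S \<and> pairwise (DC1_scrambled F) S)"

definition DC2 :: "(nat \<Rightarrow> 'a::metric_space \<Rightarrow> 'a) \<Rightarrow> bool" where
  "DC2 F \<longleftrightarrow> (\<exists>S. uncountable S \<and> pairwise (DC2_scrambled F) S)"

definition DC3 :: "(nat \<Rightarrow> 'a::metric_space \<Rightarrow> 'a) \<Rightarrow> bool" where
  "DC3 F \<longleftrightarrow> (\<exists>S. uncountable S \<and> pairwise (DC3_scrambled F) S)"

section \<open>Basic facts: the distances are metrics\<close>

lemma iterate_const: "iterate (\<lambda>_. f) n = f ^^ n"
  by (induction n) auto

lemma compact_cantor_set: "compact cantor_set"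
proof -
  have "compact (cantor_stage n)" for n
  proof (induction n)
    case (Suc n)
    then show ?case
      by (auto intro!: compact_Un compact_continuous_image continuous_intros)
  qed auto
  then have "closed (\<Inter>n. cantor_stage n)" "bounded (cantor_stage 0)"
    by (auto simp: compact_imp_closed)
  then show ?thesis
    unfolding cantor_set_def compact_eq_bounded_closed by (meson INT_lower UNIV_I bounded_subset)
qed

lemma bounded_if_cantor:
  assumes "(UNIV :: 'a::metric_space set) homeomorphic cantor_set"
  shows "bounded (UNIV :: 'a set)"
  using assms compact_cantor_set compact_imp_bounded homeomorphic_compactness by blast

lemma rho_sup_bdd:
  assumes "bounded (UNIV :: 'a::metric_space set)"
  shows "\<exists>B. \<forall>f g :: 'a \<Rightarrow> 'a. bdd_above (range (\<lambda>x. dist (f x) (g x))) \<and> rho_sup f g \<le> B"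
proof -
  obtain B where B: "\<And>x y :: 'a. dist x y \<le> B"
    using assms unfolding bounded_two_points by auto
  then have "bdd_above (range (\<lambda>x. dist (f x) (g x))) \<and> rho_sup f g \<le> B" for f g :: "'a \<Rightarrow> 'a"
    unfolding rho_sup_def by (auto intro!: bdd_aboveI cSUP_least)
  then show ?thesis by blast
qed

lemma Metric_space_rho_sup:
  assumes "bounded (UNIV :: 'a::metric_space set)"
  shows "Metric_space (X :: ('a \<Rightarrow> 'a) set) rho_sup"
proof
  fix f g h :: "'a \<Rightarrow> 'a"
  have bdd: "bdd_above (range (\<lambda>x. dist (f x) (g x)))" for f g :: "'a \<Rightarrow> 'a"
    using rho_sup_bdd[OF assms] by auto
  have le: "dist (f x) (g x) \<le> rho_sup f g" for f g :: "'a \<Rightarrow> 'a" and x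
    unfolding rho_sup_def by (rule cSUP_upper[OF _ bdd]) simp
  show nonneg: "0 \<le> rho_sup f g"
    using le[of f undefined g] zero_le_dist order_trans by blast
  show "rho_sup f g = rho_sup g f"
    by (simp add: rho_sup_def dist_commute)
  show "rho_sup f g = 0 \<longleftrightarrow> f = g"
  proof
    assume "rho_sup f g = 0"
    then show "f = g" using le[of f _ g] by (auto simp: fun_eq_iff)
  qed (simp add: rho_sup_def)
  have "dist (f x) (h x) \<le> rho_sup f g + rho_sup g h" for x
    using le[of f x g] le[of g x h] dist_triangle[of "f x" "h x" "g x"] by linarith
  then show "rho_sup f h \<le> rho_sup f g + rho_sup g h"
    unfolding rho_sup_def[of f h] by (intro cSUP_least) auto
qed

lemma Metric_space_rho_F:
  assumes "bounded (UNIV :: 'a::metric_space set)"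
  shows "Metric_space (X :: (nat \<Rightarrow> 'a \<Rightarrow> 'a) set) rho_F"
proof
  fix F G H :: "nat \<Rightarrow> 'a \<Rightarrow> 'a"
  interpret S: Metric_space "UNIV :: ('a \<Rightarrow> 'a) set" rho_sup
    by (rule Metric_space_rho_sup[OF assms])
  have bdd: "bdd_above (range (\<lambda>n. rho_sup (F n) (G n)))" for F G :: "nat \<Rightarrow> 'a \<Rightarrow> 'a"
  proof -
    obtain B where "\<And>f g :: 'a \<Rightarrow> 'a. rho_sup f g \<le> B"
      using rho_sup_bdd[OF assms] by auto
    then show ?thesis by (auto intro!: bdd_aboveI[of _ B])
  qed
  have le: "rho_sup (F n) (G n) \<le> rho_F F G" for F G :: "nat \<Rightarrow> 'a \<Rightarrow> 'a" and n
    unfolding rho_F_def by (rule cSUP_upper[OF _ bdd]) simp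
  show "0 \<le> rho_F F G"
    using le[of F 0 G] S.nonneg order_trans by blast
  show "rho_F F G = rho_F G F"
    by (simp add: rho_F_def S.commute)
  show "rho_F F G = 0 \<longleftrightarrow> F = G"
  proof
    assume "rho_F F G = 0"
    then have "rho_sup (F n) (G n) = 0" for n
      using le[of F n G] S.nonneg[of "F n" "G n"] by linarith
    then show "F = G" by (auto simp: fun_eq_iff[of F G])
  next
    assume "F = G"
    then show "rho_F F G = 0" by (simp add: rho_F_def)
  qed
  have "rho_sup (F n) (H n) \<le> rho_F F G + rho_F G H" for n
    using le[of F n G] le[of G n H] S.triangle[of "F n" "G n" "H n"] by auto
  then show "rho_F F H \<le> rho_F F G + rho_F G H"
    unfolding rho_F_def[of F H] by (intro cSUP_least) auto
qed

end

theory Submission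
  imports Defs
begin

text \<open>Code the points of \<open>Q\<close> by a finite clopen partition of small mesh. If every orbit has an
  eventually periodic itinerary, for partitions of arbitrarily small mesh, then the distances along
  two orbits are uniformly close to eventually periodic sequences, whence
  \<open>\<psi>\<^sup>*(t') \<le> \<psi>(t)\<close> for \<open>t' < t\<close> and there is no DC3-scrambled pair. For a fixed mesh the
  condition holds on a neighbourhood of any system whose transition graph on the partition has only
  eventually periodic infinite paths, so it remains to make such systems dense. In the autonomous
  case a locally constant map does. A convergent non-autonomous system is replaced from some time on
  by a single surjective map, close to the limit, with such a graph; surjectivity is achieved because
  every nonempty clopen subset of \<open>Q\<close> maps continuously onto every other one: by an iterate of the
  ternary shift followed by a retraction.\<close>

section \<open>Eventually periodic sequences\<close>

definition eventually_periodic :: "(nat \<Rightarrow> 'b) \<Rightarrow> bool" where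
  "eventually_periodic s \<longleftrightarrow> (\<exists>N q. q > 0 \<and> (\<forall>n\<ge>N. s (n + q) = s n))"

lemma eventually_periodic_shift:
  assumes "eventually_periodic (\<lambda>n. s (n + k))"
  shows "eventually_periodic s"
proof -
  obtain N q where q: "q > 0" "\<And>n. n \<ge> N \<Longrightarrow> s (n + q + k) = s (n + k)"
    using assms unfolding eventually_periodic_def by auto
  have "s (n + q) = s n" if n: "n \<ge> N + k" for n
  proof -
    obtain i where "n = i + k" "i \<ge> N"
      using n by (metis add_le_imp_le_right le_add2 le_trans le_Suc_ex add.commute)
    then show ?thesis using q(2)[of i] by (metis add.assoc add.commute)
  qed
  then show ?thesis using q(1) unfolding eventually_periodic_def by blast
qed

lemma periodic_mult:
  fixes N q :: nat
  assumes "\<And>n. n \<ge> N \<Longrightarrow> s (n + q) = s n" and "n \<ge> N"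
  shows "s (n + k * q) = s n"
  using assms(2)
proof (induction k)
  case (Suc k)
  have "n + Suc k * q = (n + k * q) + q" by simp
  then show ?case using Suc assms(1)[of "n + k * q"] by (metis trans_le_add1)
qed simp

lemma eventually_periodic_Pair:
  assumes "eventually_periodic r" "eventually_periodic s"
  shows "eventually_periodic (\<lambda>n. (r n, s n))"
proof -
  obtain M p where p: "p > 0" "\<And>n. n \<ge> M \<Longrightarrow> r (n + p) = r n"
    using assms(1) unfolding eventually_periodic_def by auto
  obtain N q where q: "q > 0" "\<And>n. n \<ge> N \<Longrightarrow> s (n + q) = s n"
    using assms(2) unfolding eventually_periodic_def by auto
  have "r (n + q * p) = r n" if "n \<ge> M" for n
    using periodic_mult[of M r p n q] p(2) that by blast
  moreover have "s (n + q * p) = s n" if "n \<ge> N" for n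
    using periodic_mult[of N s q n p] q(2) that by (metis mult.commute)
  ultimately have "(r (n + q * p), s (n + q * p)) = (r n, s n)" if "n \<ge> max M N" for n
    using that by simp
  moreover have "q * p > 0" using p q by simp
  ultimately show ?thesis unfolding eventually_periodic_def by blast
qed

text \<open>Pigeonhole gives one repetition, and since each value determines its successor, the
  repetition propagates forward.\<close>

lemma eventually_periodic_forward:
  assumes "finite (range s)" and "\<And>n. s (Suc n) = f (s n)"
  shows "eventually_periodic s"
proof -
  have "\<not> inj s" using assms(1) finite_imageD infinite_UNIV_nat by blast
  then obtain i j where ij: "i < j" "s i = s j"
    unfolding inj_on_def by (metis linorder_neqE_nat)
  have "s (n + (j - i)) = s n" if "n \<ge> i" for n
    using that
  proof (induction n rule: nat_induct_at_least)
    case base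
    then show ?case using ij by simp
  next
    case (Suc n)
    then show ?case using assms(2)[of "n + (j - i)"] assms(2)[of n] by simp
  qed
  then show ?thesis unfolding eventually_periodic_def using ij by (metis zero_less_diff)
qed

text \<open>Here a value determines only its predecessor, so a repetition in \<open>s\<close> says
  nothing about later terms. Pigeonhole is applied instead to the powers of \<open>p\<close> as
  self-maps of \<open>V\<close>: if \<open>p ^^ i\<close> and \<open>p ^^ j\<close> agree on
  \<open>V\<close>, pulling back from later terms gives the period \<open>j - i\<close>.\<close>

lemma eventually_periodic_backward:
  assumes V: "finite V" and p: "p \<in> V \<rightarrow> V"
    and s: "\<And>n. s n \<in> V" "\<And>n. p (s (Suc n)) = s n"
  shows "eventually_periodic s"
proof -
  have pull: "(p ^^ k) (s (n + k)) = s n" for n k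
  proof (induction k arbitrary: n)
    case (Suc k)
    then show ?case using s(2)[of "n + k"] by (simp add: funpow_swap1)
  qed simp
  \<comment> \<open>Restriction places the powers in the finite set
    \<open>V \<rightarrow>\<^sub>E V\<close>.\<close>
  define r where "r k = restrict (p ^^ k) V" for k
  have "(p ^^ k) v \<in> V" if "v \<in> V" for k v
    using that p by (induction k) auto
  then have "range r \<subseteq> V \<rightarrow>\<^sub>E V" unfolding r_def by auto
  then have "finite (range r)" using finite_PiE[of V "\<lambda>_. V"] V finite_subset by blast
  then have "\<not> inj r" using finite_imageD infinite_UNIV_nat by blast
  then obtain i j where ij: "i < j" "r i = r j"
    unfolding inj_on_def by (metis linorder_neqE_nat)
  then have eq: "(p ^^ i) v = (p ^^ j) v" if "v \<in> V" for v
    using that unfolding r_def by (metis restrict_apply')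
  have "s (n + (j - i)) = s n" for n
  proof -
    have "s n = (p ^^ j) (s (n + j))" by (simp add: pull)
    also have "\<dots> = (p ^^ i) (s (n + (j - i) + i))" using eq[OF s(1)] ij by simp
    also have "\<dots> = s (n + (j - i))" by (rule pull)
    finally show ?thesis by simp
  qed
  then show ?thesis unfolding eventually_periodic_def using ij by (metis zero_less_diff)
qed

text \<open>The counting function eventually grows by the same amount \<open>m\<close> over each
  period, so it differs from a linear function by an eventually periodic, hence bounded, term, and
  the density is \<open>m / q\<close>.\<close>

lemma eventually_periodic_density:
  assumes "eventually_periodic (\<lambda>j. j \<in> A)"
  shows "convergent (\<lambda>n. real (card {j. j < n \<and> j \<in> A}) / real n)"
proof -
  obtain N q where q: "q > 0" "\<And>n. n \<ge> N \<Longrightarrow> n + q \<in> A \<longleftrightarrow> n \<in> A"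
    using assms unfolding eventually_periodic_def by auto
  define a where "a n = real (card {j. j < n \<and> j \<in> A})" for n
  have a_Suc: "a (Suc n) = a n + of_bool (n \<in> A)" for n
  proof -
    have "{j. j < Suc n \<and> j \<in> A} =
        (if n \<in> A then insert n {j. j < n \<and> j \<in> A} else {j. j < n \<and> j \<in> A})"
      by (auto simp: less_Suc_eq)
    then show ?thesis unfolding a_def by simp
  qed
  define m where "m = a (N + q) - a N"
  have step: "a (n + q) - a n = m" if "n \<ge> N" for n
    using that
  proof (induction n rule: nat_induct_at_least)
    case (Suc n)
    then show ?case using a_Suc[of n] a_Suc[of "n + q"] q(2)[of n] by simp
  qed (simp add: m_def)
  define e where "e n = a n - real n * m / real q" for n
  have "e (n + q) = e n" if "n \<ge> N" for n
    using step[OF that] q(1) unfolding e_def by (simp add: field_simps)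
  then have red: "e n \<in> e ` {..<N + q}" for n
  proof (induction n rule: less_induct)
    case (less n)
    show ?case
    proof (cases "n < N + q")
      case False
      then have "e n = e (n - q)" using less.prems[of "n - q"] by simp
      moreover have "e (n - q) \<in> e ` {..<N + q}"
        using less.IH[of "n - q"] less.prems q(1) False by simp
      ultimately show ?thesis by simp
    qed simp
  qed
  have "finite (range e)" using finite_subset[of "range e" "e ` {..<N + q}"] red by auto
  then have "bounded (range e)" by (rule finite_imp_bounded)
  then obtain K where "\<And>n. \<bar>e n\<bar> \<le> K" unfolding bounded_iff by auto
  then have "(\<lambda>n. e n / real n) \<longlonglongrightarrow> 0"
    by (intro Lim_null_comparison[OF _ lim_const_over_n[of K]] always_eventually)
      (simp add: divide_right_mono)
  then have "(\<lambda>n. m / real q + e n / real n) \<longlonglongrightarrow> m / real q"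
    using tendsto_add[OF tendsto_const, of "\<lambda>n. e n / real n" 0] by simp
  moreover have "eventually (\<lambda>n. m / real q + e n / real n = a n / real n) sequentially"
    using eventually_gt_at_top[of 0] by eventually_elim (simp add: e_def field_simps)
  ultimately have "(\<lambda>n. a n / real n) \<longlonglongrightarrow> m / real q"
    by (rule Lim_transform_eventually)
  then show ?thesis unfolding a_def convergent_def by blast
qed

section \<open>Finitely coded systems have no scrambled pairs\<close>

text \<open>The fibres of \<open>c\<close> are the cells of a partition, and
  \<open>c (iterate F n x)\<close> is the itinerary of \<open>x\<close>. One code has to serve all
  points at once.\<close>

definition finitely_coded :: "real \<Rightarrow> (nat \<Rightarrow> 'a::metric_space \<Rightarrow> 'a) \<Rightarrow> bool" where
  "finitely_coded e F \<longleftrightarrow> (\<exists>c :: 'a \<Rightarrow> nat. (\<forall>u v. c u = c v \<longrightarrow> dist u v < e) \<and>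
     (\<forall>x. eventually_periodic (\<lambda>n. c (iterate F n x))))"

lemma close_freq_mono:
  "t \<le> t' \<Longrightarrow> close_freq F x y t n \<le> close_freq F x y t' n"
  unfolding close_freq_def by (auto intro!: divide_right_mono card_mono)

text \<open>Replacing each time by its representative in the first period changes the distance
  between the orbits by less than half of \<open>t - t'\<close>. The times at which the replaced
  distance is below the midpoint of \<open>t'\<close> and \<open>t\<close> form an eventually
  periodic set, whose density separates the two sides.\<close>

lemma upper_dist_le_lower_dist:
  assumes coded: "\<And>e. e > 0 \<Longrightarrow> finitely_coded e F" and "t' < t"
  shows "upper_dist F x y t' \<le> lower_dist F x y t"
proof -
  \<comment> \<open>Each of the two orbits contributes an error below \<open>e\<close>, and
    \<open>2 * e\<close> is the distance from the midpoint to \<open>t\<close> and to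
    \<open>t'\<close>.\<close>
  define e where "e = (t - t') / 4"
  have "e > 0" using assms(2) by (simp add: e_def)
  then obtain c :: "'a \<Rightarrow> nat" where c: "\<And>u v. c u = c v \<Longrightarrow> dist u v < e"
    and per: "\<And>x. eventually_periodic (\<lambda>n. c (iterate F n x))"
    using coded unfolding finitely_coded_def by blast
  define l where "l n = (c (iterate F n x), c (iterate F n y))" for n
  have "eventually_periodic l"
    unfolding l_def by (intro eventually_periodic_Pair per)
  then obtain N q where q: "q > 0" "\<And>n. n \<ge> N \<Longrightarrow> l (n + q) = l n"
    unfolding eventually_periodic_def by auto
  define s where "s n = dist (iterate F n x) (iterate F n y)" for n
  \<comment> \<open>\<open>red\<close> folds time into the preperiod and the first period without
    changing the pair of codes.\<close>
  define red where "red n = (if n < N then n else N + (n - N) mod q)" for n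
  have red_l: "l (red n) = l n" for n
  proof (cases "n < N")
    case False
    have "l (N + (n - N) mod q + (n - N) div q * q) = l (N + (n - N) mod q)"
      by (rule periodic_mult[of N]) (auto intro: q)
    then show ?thesis using False by (simp add: red_def)
  qed (simp add: red_def)
  have close: "\<bar>s n - s (red n)\<bar> < 2 * e" for n
  proof -
    have "dist (iterate F n x) (iterate F (red n) x) < e"
      "dist (iterate F n y) (iterate F (red n) y) < e"
      using red_l[of n] by (auto simp: l_def intro!: c)
    then show ?thesis unfolding s_def abs_less_iff by metric
  qed
  define A where "A = {n. s (red n) < (t + t') / 2}"
  have "n + q \<in> A \<longleftrightarrow> n \<in> A" if "n \<ge> N" for n
  proof -
    have "n + q - N = n - N + q" using that by simp
    then have "red (n + q) = red n"
      using that unfolding red_def by (metis mod_add_self2 not_le trans_le_add1)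
    then show ?thesis unfolding A_def by simp
  qed
  then have "eventually_periodic (\<lambda>n. n \<in> A)"
    unfolding eventually_periodic_def using q(1) by blast
  then obtain L where L: "(\<lambda>n. real (card {j. j < n \<and> j \<in> A}) / real n) \<longlonglongrightarrow> L"
    using eventually_periodic_density unfolding convergent_def by blast
  have sub: "s n < t' \<Longrightarrow> n \<in> A" "n \<in> A \<Longrightarrow> s n < t" for n
  proof -
    have "\<bar>s n - s (red n)\<bar> < (t - t') / 2" using close[of n] by (simp add: e_def)
    then have "s n < t' \<Longrightarrow> s (red n) < (t + t') / 2" "s (red n) < (t + t') / 2 \<Longrightarrow> s n < t"
      by argo+
    then show "s n < t' \<Longrightarrow> n \<in> A" "n \<in> A \<Longrightarrow> s n < t" unfolding A_def by auto
  qed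
  have count:
    "real (card {j. j < n \<and> s j < t'}) / real n \<le> real (card {j. j < n \<and> j \<in> A}) / real n"
    "real (card {j. j < n \<and> j \<in> A}) / real n \<le> real (card {j. j < n \<and> s j < t}) / real n" for n
    using sub by (auto intro!: divide_right_mono card_mono)
  have lim: "(\<lambda>n. ereal (real (card {j. j < n \<and> j \<in> A}) / real n)) \<longlonglongrightarrow> ereal L"
    using L by simp
  have "upper_dist F x y t' \<le> limsup (\<lambda>n. ereal (real (card {j. j < n \<and> j \<in> A}) / real n))"
    unfolding upper_dist_def close_freq_def s_def[symmetric]
    by (intro Limsup_mono always_eventually allI) (simp add: count)
  also have "\<dots> = liminf (\<lambda>n. ereal (real (card {j. j < n \<and> j \<in> A}) / real n))"
    using lim_imp_Limsup[OF trivial_limit_sequentially lim]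
      lim_imp_Liminf[OF trivial_limit_sequentially lim] by simp
  also have "\<dots> \<le> lower_dist F x y t"
    unfolding lower_dist_def close_freq_def s_def[symmetric]
    by (intro Liminf_mono always_eventually allI) (simp add: count)
  finally show ?thesis .
qed

text \<open>The nonempty intervals between the lower and the upper distribution at different
  parameters are disjoint, so there are only countably many.\<close>

lemma not_DC3_scrambled:
  assumes "\<And>e. e > 0 \<Longrightarrow> finitely_coded e F"
  shows "\<not> DC3_scrambled F x y"
proof
  assume "DC3_scrambled F x y"
  then obtain a b where "a < b"
    and lt: "\<And>t. t \<in> {a<..<b} \<Longrightarrow> lower_dist F x y t < upper_dist F x y t"
    unfolding DC3_scrambled_def by blast
  have "\<exists>r::rat. lower_dist F x y t < ereal (of_rat r) \<and> ereal (of_rat r) < upper_dist F x y t"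
    if "t \<in> {a<..<b}" for t
    using ereal_dense3[OF lt[OF that]] by auto
  then obtain r :: "real \<Rightarrow> rat" where
    r: "\<And>t. t \<in> {a<..<b} \<Longrightarrow> lower_dist F x y t < ereal (of_rat (r t))
            \<and> ereal (of_rat (r t)) < upper_dist F x y t"
    by metis
  have "r t' \<noteq> r t" if "t' \<in> {a<..<b}" "t \<in> {a<..<b}" "t' < t" for t t'
    using r[OF that(1)] r[OF that(2)] upper_dist_le_lower_dist[OF assms that(3), of x y]
    by (metis order.strict_trans1 order.strict_trans less_irrefl)
  then have "inj_on r {a<..<b}"
    by (intro inj_onI) (metis linorder_neqE)
  then have "countable {a<..<b}" by (rule countableI')
  then show False using \<open>a < b\<close> uncountable_open_interval by blast
qed

section \<open>Comparison of the three types of distributional chaos\<close>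

lemma DC1_scrambled_imp_DC2_scrambled:
  assumes "DC1_scrambled F x y"
  shows "DC2_scrambled F x y"
proof -
  obtain t where "t > 0" "lower_dist F x y t = 0" and up: "\<forall>t>0. upper_dist F x y t = 1"
    using assms unfolding DC1_scrambled_def by blast
  then have "lower_dist F x y t < upper_dist F x y t" by simp
  then show ?thesis unfolding DC2_scrambled_def using up \<open>t > 0\<close> by blast
qed

text \<open>\<open>lower_dist\<close> is monotone in \<open>t\<close>, so a value below 1 at
  \<open>b\<close> forces values below 1 on all of \<open>(0, b)\<close>, where the upper
  distribution is 1.\<close>

lemma DC2_scrambled_imp_DC3_scrambled:
  assumes "DC2_scrambled F x y"
  shows "DC3_scrambled F x y"
proof -
  obtain b where up: "\<And>t. t > 0 \<Longrightarrow> upper_dist F x y t = 1" and b: "b > 0" "lower_dist F x y b < 1"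
    using assms unfolding DC2_scrambled_def by metis
  have "lower_dist F x y t \<le> lower_dist F x y b" if "t < b" for t
    unfolding lower_dist_def using that
    by (intro Liminf_mono always_eventually allI ereal_less_eq(3)[THEN iffD2] close_freq_mono) auto
  then have "lower_dist F x y t < upper_dist F x y t" if "t \<in> {0<..<b}" for t
    using that up b(2) by (metis greaterThanLessThan_iff order.strict_trans1)
  then show ?thesis unfolding DC3_scrambled_def using b(1) by blast
qed

lemma finitely_coded_not_chaotic:
  assumes "\<And>e. e > 0 \<Longrightarrow> finitely_coded e F"
  shows "\<not> DC1 F \<and> \<not> DC2 F \<and> \<not> DC3 F"
proof -
  have no: "countable S" if "\<And>x y. \<not> R x y" "pairwise R S" for R :: "'a \<Rightarrow> 'a \<Rightarrow> bool" and S
  proof -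
    have "S = {} \<or> (\<exists>x. S = {x})" using that unfolding pairwise_def by blast
    then show ?thesis by auto
  qed
  have "\<not> DC3_scrambled F x y" "\<not> DC2_scrambled F x y" "\<not> DC1_scrambled F x y" for x y
    using not_DC3_scrambled[OF assms, of x y] DC2_scrambled_imp_DC3_scrambled[of F x y]
      DC1_scrambled_imp_DC2_scrambled[of F x y] by auto
  then have "\<not> (\<exists>S. uncountable S \<and> pairwise (DC3_scrambled F) S)"
    "\<not> (\<exists>S. uncountable S \<and> pairwise (DC2_scrambled F) S)"
    "\<not> (\<exists>S. uncountable S \<and> pairwise (DC1_scrambled F) S)"
    using no by blast+
  then show ?thesis by (simp add: DC1_def DC2_def DC3_def)
qed

section \<open>A criterion for residual sets\<close>

text \<open>A ball inside the closure of \<open>A\<close> would contain some \<open>y\<close> with a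
  neighbourhood missing \<open>A\<close>, which is impossible for a point of the closure.\<close>

lemma (in Metric_space) nowhere_dense_in_mtopology:
  assumes "A \<subseteq> M"
    and dense: "\<And>x e. \<lbrakk>x \<in> M; e > 0\<rbrakk> \<Longrightarrow>
      \<exists>y\<in>M. d x y < e \<and> (\<exists>r>0. \<forall>z\<in>M. d y z < r \<longrightarrow> z \<notin> A)"
  shows "nowhere_dense_in mtopology A"
proof -
  have "x \<notin> mtopology interior_of (mtopology closure_of A)" for x
  proof
    assume "x \<in> mtopology interior_of (mtopology closure_of A)"
    then obtain U where U: "openin mtopology U" "x \<in> U" "U \<subseteq> mtopology closure_of A"
      unfolding interior_of_def by blast
    then obtain e where e: "e > 0" "mball x e \<subseteq> U"
      unfolding openin_mtopology by blast
    have "x \<in> M" using U by (meson openin_mtopology subsetD)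
    then obtain y r where y: "y \<in> M" "d x y < e" "r > 0" "\<And>z. \<lbrakk>z \<in> M; d y z < r\<rbrakk> \<Longrightarrow> z \<notin> A"
      using dense e(1) by blast
    then have "y \<in> mtopology closure_of A"
      using \<open>x \<in> M\<close> e U(3) by (auto simp: subset_iff in_mball)
    then show False using y unfolding metric_closure_of by (auto simp: in_mball)
  qed
  then show ?thesis unfolding nowhere_dense_in_def using assms(1) by auto
qed

text \<open>Each \<open>P k\<close> holds on a dense open set, and \<open>S\<close> contains the
  intersection of these sets.\<close>

lemma (in Metric_space) residual_in_mtopology:
  fixes P :: "nat \<Rightarrow> 'a \<Rightarrow> bool"
  assumes "S \<subseteq> M" and S: "\<And>x. \<lbrakk>x \<in> M; \<And>k. P k x\<rbrakk> \<Longrightarrow> x \<in> S"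
    and dense: "\<And>k x e. \<lbrakk>x \<in> M; e > 0\<rbrakk> \<Longrightarrow>
      \<exists>y\<in>M. d x y < e \<and> (\<exists>r>0. \<forall>z\<in>M. d y z < r \<longrightarrow> P k z)"
  shows "residual_in mtopology S"
proof -
  \<comment> \<open>Removing \<open>S\<close> makes the union exactly \<open>M - S\<close>, as
    \<open>residual_in\<close> asks for an equality.\<close>
  define B where "B k = {x \<in> M - S. \<not> P k x}" for k
  have "nowhere_dense_in mtopology (B k)" for k
  proof (rule nowhere_dense_in_mtopology)
    show "\<exists>y\<in>M. d x y < e \<and> (\<exists>r>0. \<forall>z\<in>M. d y z < r \<longrightarrow> z \<notin> B k)" if "x \<in> M" "e > 0" for x e
      using dense[OF that, of k] unfolding B_def by blast
  qed (auto simp: B_def)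
  moreover have "M - S = \<Union>(range B)" using S unfolding B_def by blast
  ultimately show ?thesis
    unfolding residual_in_def using assms(1) by (intro conjI exI[of _ "range B"]) auto
qed

section \<open>Pointwise bounds for the two supremum metrics\<close>

lemma dist_le_rho_sup:
  fixes f g :: "'a::metric_space \<Rightarrow> 'a"
  assumes "bounded (UNIV :: 'a set)"
  shows "dist (f x) (g x) \<le> rho_sup f g"
  unfolding rho_sup_def using rho_sup_bdd[OF assms] by (intro cSUP_upper) auto

lemma rho_sup_le: "(\<And>x. dist (f x) (g x) \<le> e) \<Longrightarrow> rho_sup f g \<le> e"
  unfolding rho_sup_def by (intro cSUP_least) auto

lemma rho_sup_le_rho_F:
  fixes F G :: "nat \<Rightarrow> 'a::metric_space \<Rightarrow> 'a"
  assumes "bounded (UNIV :: 'a set)"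
  shows "rho_sup (F n) (G n) \<le> rho_F F G"
proof -
  obtain B where "\<And>f g :: 'a \<Rightarrow> 'a. rho_sup f g \<le> B"
    using rho_sup_bdd[OF assms] by auto
  then show ?thesis
    unfolding rho_F_def by (intro cSUP_upper) (auto intro!: bdd_aboveI[of _ B])
qed

lemma rho_F_le: "(\<And>n x. dist (F n x) (G n x) \<le> e) \<Longrightarrow> rho_F F G \<le> e"
  unfolding rho_F_def by (intro cSUP_least rho_sup_le) auto

section \<open>Locally constant functions\<close>

text \<open>Continuity into a discrete space, phrased with filters so that the values need no
  topology.\<close>

definition locally_constant :: "('a::topological_space \<Rightarrow> 'b) \<Rightarrow> bool" where
  "locally_constant c \<longleftrightarrow> (\<forall>x. \<forall>\<^sub>F y in nhds x. c y = c x)"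

lemma locally_constant_map:
  assumes "locally_constant c"
  shows "locally_constant (\<lambda>x. F (c x))"
  unfolding locally_constant_def
proof
  fix x
  have "\<forall>\<^sub>F y in nhds x. c y = c x" using assms unfolding locally_constant_def by blast
  then show "\<forall>\<^sub>F y in nhds x. F (c y) = F (c x)" by eventually_elim simp
qed

lemma locally_constant_Pair:
  assumes "locally_constant c" "locally_constant c'"
  shows "locally_constant (\<lambda>x. (c x, c' x))"
  using assms unfolding locally_constant_def by (simp add: eventually_conj_iff)

lemma locally_constant_compose:
  fixes f :: "'a::t2_space \<Rightarrow> 'b::topological_space"
  assumes "locally_constant c" "continuous_on UNIV f"
  shows "locally_constant (\<lambda>x. c (f x))"
proof -
  have "filterlim f (nhds (f x)) (nhds x)" for x
    using assms(2) by (simp add: continuous_on_eq_continuous_at isCont_def tendsto_at_iff_tendsto_nhds)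
  then show ?thesis
    using assms(1) eventually_compose_filterlim[of "\<lambda>y. c y = c (f x)" "nhds (f x)" f "nhds x" for x]
    unfolding locally_constant_def by blast
qed

lemma open_locally_constant_fibre:
  assumes "locally_constant c"
  shows "open {x. c x = v}"
proof (subst open_subopen, safe)
  fix x
  have "\<forall>\<^sub>F y in nhds x. c y = c x" using assms unfolding locally_constant_def by blast
  then obtain U where "open U" "x \<in> U" "\<forall>y\<in>U. c y = c x"
    unfolding eventually_nhds by blast
  then show "\<exists>U. open U \<and> x \<in> U \<and> U \<subseteq> {y. c y = c x}"
    by blast
qed

lemma continuous_on_locally_constant_glue:
  fixes G :: "'b \<Rightarrow> 'a::t2_space \<Rightarrow> 'c::topological_space"
  assumes "locally_constant c" "\<And>v. continuous_on UNIV (G v)"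
  shows "continuous_on UNIV (\<lambda>x. G (c x) x)"
proof -
  have "isCont (\<lambda>y. G (c y) y) x" for x
  proof -
    have "\<forall>\<^sub>F y in nhds x. c y = c x" using assms(1) unfolding locally_constant_def by blast
    then have "\<forall>\<^sub>F y in nhds x. G (c y) y = G (c x) y" by eventually_elim simp
    moreover have "isCont (G (c x)) x"
      using assms(2) by (simp add: continuous_on_eq_continuous_at)
    ultimately show ?thesis using isCont_cong by fastforce
  qed
  then show ?thesis by (simp add: continuous_on_eq_continuous_at)
qed

text \<open>\<open>r\<close> is a Lebesgue number of the cover by fibres. It turns a perturbation
  smaller than \<open>r\<close> into equality of codes.\<close>

lemma locally_constant_uniform:
  fixes c :: "'a::metric_space \<Rightarrow> 'b"
  assumes "compact (UNIV :: 'a set)" "locally_constant c"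
  obtains r where "r > 0" "\<And>x y. dist x y < r \<Longrightarrow> c x = c y"
proof -
  have "UNIV \<subseteq> \<Union>(range (\<lambda>v. {x. c x = v}))" by blast
  moreover have "open U" if "U \<in> range (\<lambda>v. {x. c x = v})" for U
    using that open_locally_constant_fibre[OF assms(2)] by blast
  ultimately obtain r where r: "r > 0" "\<And>x. \<exists>U \<in> range (\<lambda>v. {x. c x = v}). ball x r \<subseteq> U"
    using Heine_Borel_lemma[OF assms(1), of "range (\<lambda>v. {x. c x = v})"] by (metis UNIV_I)
  have "c x = c y" if "dist x y < r" for x y
  proof -
    obtain v where "ball x r \<subseteq> {x. c x = v}" using r(2)[of x] by blast
    moreover have "x \<in> ball x r" "y \<in> ball x r" using that r(1) by auto
    ultimately show ?thesis by blast
  qed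
  with r(1) show ?thesis using that by blast
qed

lemma finite_range_locally_constant:
  fixes c :: "'a::topological_space \<Rightarrow> 'b"
  assumes "compact (UNIV :: 'a set)" "locally_constant c"
  shows "finite (range c)"
proof -
  have "UNIV \<subseteq> (\<Union>v\<in>range c. {x. c x = v})" by blast
  then obtain V where "finite V" "UNIV \<subseteq> (\<Union>v\<in>V. {x. c x = v})"
    using compactE_image[OF assms(1), of "range c" "\<lambda>v. {x. c x = v}"]
      open_locally_constant_fibre[OF assms(2)] by metis
  then show ?thesis by (auto intro: finite_subset[of "range c" V])
qed

section \<open>Topological exactness and clopen partitions of small mesh\<close>

definition locally_eventually_onto :: "('a::topological_space \<Rightarrow> 'a) \<Rightarrow> bool" where
  "locally_eventually_onto T \<longleftrightarrow> (\<forall>U. open U \<and> U \<noteq> {} \<longrightarrow> (\<exists>n. (T ^^ n) ` U = UNIV))"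

text \<open>There are finitely many fibres, and composing with further powers of the surjection
  \<open>T\<close> keeps an image equal to the whole space, so one exponent serves all
  fibres.\<close>

lemma locally_eventually_onto_fibres:
  assumes "compact (UNIV :: 'a set)" "locally_constant c"
    and T: "surj T" "locally_eventually_onto (T :: 'a::topological_space \<Rightarrow> 'a)"
  obtains m where "\<And>v z. v \<in> range c \<Longrightarrow> \<exists>x. c x = v \<and> (T ^^ m) x = z"
proof -
  have "\<exists>n. (T ^^ n) ` {x. c x = v} = UNIV" if "v \<in> range c" for v
  proof -
    have "{x. c x = v} \<noteq> {}" using that by blast
    then show ?thesis
      using T(2) open_locally_constant_fibre[OF assms(2), of v]
      unfolding locally_eventually_onto_def by blast
  qed
  then obtain n where n: "\<And>v. v \<in> range c \<Longrightarrow> (T ^^ n v) ` {x. c x = v} = UNIV"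
    by metis
  define m where "m = Max (n ` range c)"
  have "\<exists>x. c x = v \<and> (T ^^ m) x = z" if v: "v \<in> range c" for v z
  proof -
    have "n v \<le> m"
      unfolding m_def using v finite_range_locally_constant[OF assms(1,2)] by (intro Max_ge) auto
    then have "T ^^ m = (T ^^ (m - n v)) \<circ> (T ^^ n v)" by (metis funpow_add le_add_diff_inverse2)
    moreover obtain w where "(T ^^ (m - n v)) w = z" using surj_fn[OF T(1)] by (metis surjD)
    moreover have "w \<in> (T ^^ n v) ` {x. c x = v}" using n[OF v] by simp
    then obtain x where "c x = v" "(T ^^ n v) x = w" by (auto elim!: imageE)
    ultimately show ?thesis by auto
  qed
  then show ?thesis using that by blast
qed

definition has_fine_codes :: "'a::metric_space itself \<Rightarrow> bool" where
  "has_fine_codes _ \<longleftrightarrow>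
     (\<forall>e>0. \<exists>c :: 'a \<Rightarrow> nat. locally_constant c \<and> (\<forall>u v. c u = c v \<longrightarrow> dist u v < e))"

section \<open>Density of finitely coded systems\<close>

text \<open>\<open>cont_maps\<close> does not require surjectivity, so \<open>f\<close> may be
  replaced on each cell by its value at one representative. Any \<open>h\<close> close enough to
  this map moves the code by a function of the code alone.\<close>

lemma autonomous_dense:
  fixes f :: "'a::metric_space \<Rightarrow> 'a"
  assumes compact: "compact (UNIV :: 'a set)" and codes: "has_fine_codes TYPE('a)"
    and f: "continuous_on UNIV f" and "e > 0" "k > 0"
  obtains g r where "continuous_on UNIV g" "rho_sup f g < e" "r > 0"
    "\<And>h. rho_sup g h < r \<Longrightarrow> finitely_coded k (\<lambda>_. h)"
proof -
  have "uniformly_continuous_on UNIV f"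
    using compact_uniformly_continuous[OF f compact] .
  then obtain d where d: "d > 0" "\<And>u v. dist u v < d \<Longrightarrow> dist (f u) (f v) < e / 2"
    using \<open>e > 0\<close> unfolding uniformly_continuous_on_def by (metis UNIV_I half_gt_zero)
  \<comment> \<open>Mesh below \<open>d\<close> keeps \<open>g\<close> near \<open>f\<close>; mesh
    below \<open>k\<close> makes \<open>c\<close> a valid code for
    \<open>finitely_coded k\<close>.\<close>
  have "min d k > 0" using d \<open>k > 0\<close> by simp
  then obtain c :: "'a \<Rightarrow> nat" where c: "locally_constant c" "\<And>u v. c u = c v \<Longrightarrow> dist u v < min d k"
    using codes unfolding has_fine_codes_def by blast
  have c_inv: "c (inv c (c x)) = c x" for x by (simp add: f_inv_into_f)
  define g where "g x = f (inv c (c x))" for x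
  obtain r where r: "r > 0" "\<And>x y. dist x y < r \<Longrightarrow> c x = c y"
    using locally_constant_uniform[OF compact c(1)] by blast
  show ?thesis
  proof
    show "continuous_on UNIV g"
      using continuous_on_locally_constant_glue[OF c(1), of "\<lambda>v _. f (inv c v)"]
      by (simp add: g_def[abs_def])
    have "dist (f x) (g x) < e / 2" for x
      unfolding g_def using c(2)[of x "inv c (c x)"] c_inv by (intro d(2)) simp
    then have "rho_sup f g \<le> e / 2" by (intro rho_sup_le) (simp add: less_imp_le)
    then show "rho_sup f g < e" using \<open>e > 0\<close> by simp
    show "r > 0" by (fact r)
    fix h assume h: "rho_sup g h < r"
    have "c (h x) = c (f (inv c (c x)))" for x
      using r(2)[of "g x" "h x"] dist_le_rho_sup[OF compact_imp_bounded[OF compact], of g x h] h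
      by (simp add: g_def)
    then have "eventually_periodic (\<lambda>n. c (iterate (\<lambda>_. h) n x))" for x
      by (intro eventually_periodic_forward[where f = "\<lambda>v. c (f (inv c v))"]
          finite_subset[OF _ finite_range_locally_constant[OF compact c(1)]]) auto
    then show "finitely_coded k (\<lambda>_. h)"
      unfolding finitely_coded_def using c(2) by auto
  qed
qed

text \<open>Every fibre of the code \<open>c\<close> is halved by the bit \<open>b\<close>. Where \<open>b\<close> holds, the code moves
  forward along a successor function \<open>s\<close>; where it fails, the code either moves backward along a
  predecessor function \<open>p\<close>, or moves along \<open>s\<close> or \<open>p\<close> into the region where \<open>b\<close> holds and is
  deterministic from then on. Each fibre lies in the target of its predecessor, so \<open>g\<close> is onto.\<close>

lemma surjective_model:
  fixes f :: "'a::metric_space \<Rightarrow> 'a" and T :: "'a \<Rightarrow> 'a" and b0 :: "'a \<Rightarrow> bool"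
  assumes compact: "compact (UNIV :: 'a set)" and codes: "has_fine_codes TYPE('a)"
    and T: "continuous_on UNIV T" "surj T" "locally_eventually_onto T"
    and b0: "locally_constant b0" "surj b0"
    and f: "continuous_on UNIV f" "surj f" and "e > 0" "k > 0"
  obtains g r and c :: "'a \<Rightarrow> nat" where "continuous_on UNIV g" "surj g" "\<And>x. dist (f x) (g x) < e"
    "r > 0" "\<And>u v. c u = c v \<Longrightarrow> dist u v < k"
    "\<And>z. (\<And>n. dist (g (z n)) (z (Suc n)) < r) \<Longrightarrow> eventually_periodic (\<lambda>n. c (z n))"
proof -
  have "uniformly_continuous_on UNIV f"
    using compact_uniformly_continuous[OF f(1) compact] .
  then obtain d where d: "d > 0" "\<And>u v. dist u v < d \<Longrightarrow> dist (f u) (f v) < e / 2"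
    using \<open>e > 0\<close> unfolding uniformly_continuous_on_def by (metis UNIV_I half_gt_zero)
  \<comment> \<open>In \<open>target_dist\<close> the bound \<open>d\<close> moves \<open>x\<close>
    within its fibre and \<open>e / 2\<close> moves the image within its fibre; \<open>k\<close> is
    the mesh demanded in the conclusion.\<close>
  have "min (min d k) (e / 2) > 0" using d \<open>k > 0\<close> \<open>e > 0\<close> by simp
  then obtain c :: "'a \<Rightarrow> nat" where c: "locally_constant c"
    and c_min: "\<And>u v. c u = c v \<Longrightarrow> dist u v < min (min d k) (e / 2)"
    using codes unfolding has_fine_codes_def by blast
  have c_dist: "dist u v < d" "dist u v < k" "dist u v < e / 2" if "c u = c v" for u v
    using c_min[OF that] by auto
  have fin: "finite (range c)" by (rule finite_range_locally_constant[OF compact c])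
  have T_pow: "continuous_on UNIV (T ^^ n)" for n
  proof (induction n)
    case (Suc n)
    then show ?case using continuous_on_compose[of UNIV "T ^^ n" T] continuous_on_subset[OF T(1)] by auto
  qed (simp add: id_def[symmetric])

  \<comment> \<open>Since \<open>T ^^ i\<close> maps each fibre of \<open>c\<close> onto the space,
    composing \<open>b0\<close> with it gives a bit that takes both values on each fibre.\<close>
  obtain i where i: "\<And>v z. v \<in> range c \<Longrightarrow> \<exists>x. c x = v \<and> (T ^^ i) x = z"
    using locally_eventually_onto_fibres[OF compact c T(2,3)] by blast
  define b where "b x = b0 ((T ^^ i) x)" for x
  have b: "locally_constant b"
    unfolding b_def[abs_def] by (rule locally_constant_compose[OF b0(1) T_pow])
  have cb_ex: "\<exists>x. c x = v \<and> b x = \<beta>" if "v \<in> range c" for v \<beta>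
    using i[OF that] b0(2) unfolding b_def by (metis surjD)
  have cb: "locally_constant (\<lambda>x. (c x, b x))" by (rule locally_constant_Pair[OF c b])
  obtain j where j: "\<And>w z. w \<in> range (\<lambda>x. (c x, b x)) \<Longrightarrow> \<exists>x. (c x, b x) = w \<and> (T ^^ j) x = z"
    using locally_eventually_onto_fibres[OF compact cb T(2,3)] by blast

  \<comment> \<open>\<open>s\<close> and \<open>p\<close> follow \<open>f\<close> forward and
    backward through chosen representatives of the fibres.\<close>
  define s where "s v = c (f (inv c v))" for v
  define p where "p w = c (inv f (inv c w))" for w
  \<comment> \<open>The permitted images of the half-fibre \<open>(v, \<beta>)\<close>. The first
    alternative is kept also where \<open>b\<close> fails, so that the target is nonempty even if
    \<open>p\<close> never takes the value \<open>v\<close>.\<close>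
  define target where "target v \<beta> y \<longleftrightarrow> c y = s v \<and> b y \<or> \<not> \<beta> \<and> p (c y) = v" for v \<beta> y
  have target_ex: "\<exists>y. target v \<beta> y" for v \<beta>
    using cb_ex[of "s v" True] unfolding target_def s_def by blast
  have target_dist: "dist (f x) y < e" if "target (c x) \<beta> y" for x \<beta> y
  proof -
    \<comment> \<open>Either kind of move is realised by \<open>f\<close> itself at some point of
      the fibre of \<open>x\<close>.\<close>
    have "\<exists>x'. c x' = c x \<and> c (f x') = c y"
    proof (cases "c y = s (c x)")
      case True
      then show ?thesis unfolding s_def by (intro exI[of _ "inv c (c x)"]) (simp add: f_inv_into_f)
    next
      case False
      then have "p (c y) = c x" using that unfolding target_def by blast
      then show ?thesis unfolding p_def
        by (intro exI[of _ "inv f (inv c (c y))"]) (simp add: f_inv_into_f f(2))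
    qed
    then obtain x' where "c x = c x'" "c (f x') = c y" by metis
    then have "dist (f x) (f x') < e / 2" "dist (f x') y < e / 2"
      using d(2) c_dist by auto
    then show ?thesis using dist_triangle_half_r by (metis dist_commute)
  qed

  \<comment> \<open>\<open>T ^^ j\<close> is kept where it lands in the target, and all other points
    go to one fixed point of the target. Since \<open>T ^^ j\<close> maps each half-fibre onto the
    whole space, every point of the target is attained.\<close>
  define G where "G = (\<lambda>(v, \<beta>, t) x. if t then (T ^^ j) x else (SOME y. target v \<beta> y))"
  define g where "g x = G (c x, b x, target (c x) (b x) ((T ^^ j) x)) x" for x
  have target_g: "target (c x) (b x) (g x)" for x
    using someI_ex[OF target_ex] unfolding g_def G_def by auto
  have "locally_constant (\<lambda>x. ((c x, b x), (c ((T ^^ j) x), b ((T ^^ j) x))))"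
    by (intro locally_constant_Pair c b locally_constant_compose[OF c T_pow]
        locally_constant_compose[OF b T_pow])
  \<comment> \<open>\<open>target\<close> sees a point only through its two codes, so the flag
    choosing between the branches of \<open>G\<close> is a function of locally constant
    data.\<close>
  from locally_constant_map[OF this, of "\<lambda>((v, \<beta>), (v', \<beta>')). (v, \<beta>, v' = s v \<and> \<beta>' \<or> \<not> \<beta> \<and> p v' = v)"]
  have lc: "locally_constant (\<lambda>x. (c x, b x, target (c x) (b x) ((T ^^ j) x)))"
    unfolding target_def by simp
  have "continuous_on UNIV (G w)" for w
  proof (cases w)
    case (fields v \<beta> t)
    then show ?thesis using T_pow[of j] by (cases t) (simp_all add: G_def)
  qed
  then have g_cont: "continuous_on UNIV g"
    using continuous_on_locally_constant_glue[OF lc, of G] unfolding g_def[abs_def] by blast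
  have g_surj: "surj g"
    unfolding surj_def
  proof
    fix y
    have "p (c y) \<in> range c" unfolding p_def by simp
    from cb_ex[OF this, of False] have "(p (c y), False) \<in> range (\<lambda>x. (c x, b x))" by force
    then obtain x where "c x = p (c y)" "\<not> b x" "(T ^^ j) x = y" using j by blast
    then have "g x = y" unfolding g_def G_def target_def by simp
    then show "\<exists>x. y = g x" by blast
  qed

  obtain r where r: "r > 0" "\<And>x y. dist x y < r \<Longrightarrow> (c x, b x) = (c y, b y)"
    using locally_constant_uniform[OF compact cb] by blast
  \<comment> \<open>\<open>z\<close> is an \<open>r\<close>-pseudo-orbit of \<open>g\<close>, which
    is how orbits of non-autonomous systems near \<open>g\<close> appear.\<close>
  have "eventually_periodic (\<lambda>n. c (z n))" if z: "\<And>n. dist (g (z n)) (z (Suc n)) < r" for z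
  proof -
    have step: "target (c (z n)) (b (z n)) (z (Suc n))" for n
      using target_g[of "z n"] r(2)[OF z[of n]] unfolding target_def by simp
    show ?thesis
    proof (cases "\<exists>n. b (z n)")
      case True
      then obtain n where n: "b (z n)" by blast
      have bn: "b (z (m + n))" for m
        using n step by (induction m) (auto simp: target_def)
      have "c (z (Suc m + n)) = s (c (z (m + n)))" for m
        using bn[of m] step[of "m + n"] by (simp add: target_def)
      then have "eventually_periodic (\<lambda>m. c (z (m + n)))"
        by (intro eventually_periodic_forward[where f = s] finite_subset[OF _ fin]) auto
      then show ?thesis by (rule eventually_periodic_shift)
    next
      case False
      \<comment> \<open>The first alternative of \<open>target\<close> would put
        \<open>z (Suc n)\<close> where \<open>b\<close> holds, so only the move along
        \<open>p\<close> remains.\<close>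
      then have "p (c (z (Suc n))) = c (z n)" for n
        using step[of n] unfolding target_def by blast
      then show ?thesis
        by (intro eventually_periodic_backward[OF fin, of p]) (auto simp: p_def)
    qed
  qed
  then show ?thesis
    using that[OF g_cont g_surj target_dist[OF target_g] r(1) c_dist(2)] by blast
qed

text \<open>The maps before time \<open>N\<close> are kept. All later ones are replaced by a model
  of \<open>F N\<close>, which is continuous and surjective by the definition of
  \<open>conv_systems\<close> and close to every later \<open>F n\<close> by convergence.\<close>

lemma nonautonomous_dense:
  fixes F :: "nat \<Rightarrow> 'a::metric_space \<Rightarrow> 'a" and T :: "'a \<Rightarrow> 'a" and b0 :: "'a \<Rightarrow> bool"
  assumes compact: "compact (UNIV :: 'a set)" and codes: "has_fine_codes TYPE('a)"
    and T: "continuous_on UNIV T" "surj T" "locally_eventually_onto T"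
    and b0: "locally_constant b0" "surj b0"
    and F: "F \<in> conv_systems" and "e > 0" "k > 0"
  obtains G r where "G \<in> conv_systems" "rho_F F G < e" "r > 0"
    "\<And>H. rho_F G H < r \<Longrightarrow> finitely_coded k H"
proof -
  have bdd: "bounded (UNIV :: 'a set)" by (rule compact_imp_bounded[OF compact])
  have F_cont: "continuous_on UNIV (F n)" and F_surj: "surj (F n)" for n
    using F unfolding conv_systems_def by auto
  obtain f where "(\<lambda>n. rho_sup (F n) f) \<longlonglongrightarrow> 0"
    using F unfolding conv_systems_def by auto
  then have "eventually (\<lambda>n. rho_sup (F n) f < e / 6) sequentially"
    using \<open>e > 0\<close> by (intro order_tendstoD) auto
  then obtain N where N: "\<And>n. n \<ge> N \<Longrightarrow> rho_sup (F n) f < e / 6"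
    unfolding eventually_sequentially by blast
  have near: "dist (F n x) (F N x) < e / 3" if "n \<ge> N" for n x
    using N[OF that] N[of N] dist_le_rho_sup[OF bdd, of "F n" x f]
      dist_le_rho_sup[OF bdd, of "F N" x f] dist_triangle2[of "F n x" "F N x" "f x"] by simp
  have "e / 3 > 0" using \<open>e > 0\<close> by simp
  obtain g r and c :: "'a \<Rightarrow> nat"
    where g: "continuous_on UNIV g" "surj g" "\<And>x. dist (F N x) (g x) < e / 3"
    and r: "r > 0" and c: "\<And>u v. c u = c v \<Longrightarrow> dist u v < k"
    and per: "\<And>z. (\<And>n. dist (g (z n)) (z (Suc n)) < r) \<Longrightarrow> eventually_periodic (\<lambda>n. c (z n))"
    using surjective_model[OF compact codes T b0 F_cont F_surj \<open>e / 3 > 0\<close> \<open>k > 0\<close>, of N] by metis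
  define G where "G n = (if n < N then F n else g)" for n
  show ?thesis
  proof
    have "eventually (\<lambda>n. 0 = rho_sup (G n) g) sequentially"
      using eventually_ge_at_top[of N] by eventually_elim (simp add: G_def rho_sup_def)
    then have "(\<lambda>n. rho_sup (G n) g) \<longlonglongrightarrow> 0"
      by (rule Lim_transform_eventually[OF tendsto_const])
    then show "G \<in> conv_systems"
      unfolding conv_systems_def using F_cont F_surj g by (auto simp: G_def)
    have "dist (F n x) (G n x) \<le> 2 * e / 3" for n x
      using near[of n x] g(3)[of x] dist_triangle[of "F n x" "g x" "F N x"] \<open>e > 0\<close>
      by (auto simp: G_def not_less)
    then have "rho_F F G \<le> 2 * e / 3" by (rule rho_F_le)
    then show "rho_F F G < e" using \<open>e > 0\<close> by simp
    show "r > 0" by (fact r)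
    fix H assume H: "rho_F G H < r"
    have "eventually_periodic (\<lambda>n. c (iterate H n x))" for x
    \<comment> \<open>From time \<open>N\<close> on the orbit of \<open>H\<close> is an
      \<open>r\<close>-pseudo-orbit of \<open>g\<close>; the first \<open>N\<close> steps follow
      other maps and are dropped.\<close>
    proof (rule eventually_periodic_shift[of _ N], rule per)
      fix n
      show "dist (g (iterate H (n + N) x)) (iterate H (Suc n + N) x) < r"
        using dist_le_rho_sup[OF bdd, of "G (n + N)" "iterate H (n + N) x" "H (n + N)"]
          rho_sup_le_rho_F[OF bdd, of G "n + N" H] H by (simp add: G_def)
    qed
    then show "finitely_coded k H" unfolding finitely_coded_def using c by blast
  qed
qed

section \<open>The Cantor set\<close>

text \<open>On the Cantor set this deletes the first ternary digit. The cut at \<open>1 / 2\<close>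
  lies in the middle gap, so the two affine branches do not meet there.\<close>

definition ternary_shift :: "real \<Rightarrow> real" where
  "ternary_shift x = (if x < 1 / 2 then 3 * x else 3 * x - 2)"

lemma cantor_stage_subset: "cantor_stage n \<subseteq> {0..1}"
  by (induction n) auto

lemma cantor_set_bounds: "x \<in> cantor_set \<Longrightarrow> 0 \<le> x \<and> x \<le> 1"
  using cantor_stage_subset[of 0] unfolding cantor_set_def by (metis INT_iff UNIV_I atLeastAtMost_iff subsetD)

lemma cantor_set_gap:
  assumes "x \<in> cantor_set"
  shows "x \<le> 1 / 3 \<or> x \<ge> 2 / 3"
proof -
  have "x \<in> cantor_stage (Suc 0)" using assms unfolding cantor_set_def by blast
  then show ?thesis by auto
qed

lemma ternary_shift_cantor_set:
  assumes "x \<in> cantor_set"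
  shows "ternary_shift x \<in> cantor_set"
proof -
  have "ternary_shift x \<in> cantor_stage n" for n
  proof -
    have "x \<in> cantor_stage (Suc n)" using assms unfolding cantor_set_def by blast
    then show ?thesis
      using cantor_stage_subset[of n] unfolding ternary_shift_def by (force simp: field_simps)
  qed
  then show ?thesis unfolding cantor_set_def by blast
qed

lemma cantor_set_branches:
  assumes "x \<in> cantor_set"
  shows "x / 3 \<in> cantor_set" "2 / 3 + x / 3 \<in> cantor_set"
proof -
  have "x / 3 \<in> cantor_stage n \<and> 2 / 3 + x / 3 \<in> cantor_stage n" for n
  proof (cases n)
    case 0
    then show ?thesis using cantor_set_bounds[OF assms] by simp
  next
    case (Suc m)
    then show ?thesis using assms unfolding cantor_set_def by auto
  qed
  then show "x / 3 \<in> cantor_set" "2 / 3 + x / 3 \<in> cantor_set" unfolding cantor_set_def by auto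
qed

lemma continuous_on_ternary_shift: "continuous_on cantor_set ternary_shift"
proof -
  have "continuous_on ({..1/3} \<union> {2/3..}) ternary_shift"
  proof (rule continuous_on_closed_Un)
    have "continuous_on {..1/3} (\<lambda>x::real. 3 * x)" by (intro continuous_intros)
    then show "continuous_on {..1/3} ternary_shift"
      by (rule continuous_on_eq) (auto simp: ternary_shift_def)
    have "continuous_on {2/3..} (\<lambda>x::real. 3 * x - 2)" by (intro continuous_intros)
    then show "continuous_on {2/3..} ternary_shift"
      by (rule continuous_on_eq) (auto simp: ternary_shift_def)
  qed auto
  then show ?thesis by (rule continuous_on_subset) (auto dest: cantor_set_gap)
qed

text \<open>The shift \<open>T\<close>, the first digit \<open>b\<close> (true for 0) and the real
  coordinate \<open>h\<close> are carried over to \<open>'a\<close>. The metric of \<open>'a\<close>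
  is only compatible, so it is compared with \<open>h\<close> through uniform continuity of the
  inverse homeomorphism.\<close>

lemma cantor_space_structure:
  assumes "(UNIV :: 'a::metric_space set) homeomorphic cantor_set"
  obtains T :: "'a::metric_space \<Rightarrow> 'a" and b :: "'a::metric_space \<Rightarrow> bool"
    and h :: "'a::metric_space \<Rightarrow> real" where
    "continuous_on UNIV T" "locally_constant b"
    "\<And>x. 0 \<le> h x \<and> h x \<le> 1"
    "\<And>x y. b x = b y \<Longrightarrow> \<bar>h x - h y\<bar> = \<bar>h (T x) - h (T y)\<bar> / 3"
    "\<And>\<beta> z. \<exists>x. b x = \<beta> \<and> T x = z"
    "\<And>e. e > 0 \<Longrightarrow> \<exists>d>0. \<forall>x y. \<bar>h x - h y\<bar> < d \<longrightarrow> dist x y < e"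
proof -
  obtain h :: "'a \<Rightarrow> real" and k where hk: "homeomorphism UNIV cantor_set h k"
    using assms unfolding homeomorphic_def by blast
  have h_in: "h x \<in> cantor_set" and kh: "k (h x) = x" for x
    using hk unfolding homeomorphism_def by auto
  have hk_inv: "h (k u) = u" if "u \<in> cantor_set" for u
    using hk that unfolding homeomorphism_def by auto
  have h_cont: "continuous_on UNIV h" and k_cont: "continuous_on cantor_set k"
    using hk unfolding homeomorphism_def by auto
  define T where "T x = k (ternary_shift (h x))" for x
  define b where "b x \<longleftrightarrow> h x < 1 / 2" for x
  have hT: "h (T x) = ternary_shift (h x)" for x
    unfolding T_def using hk_inv ternary_shift_cantor_set h_in by blast
  show ?thesis
  proof (rule that[of T b h])
    have "continuous_on UNIV (\<lambda>x. ternary_shift (h x))"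
      using h_in by (intro continuous_on_compose2[OF continuous_on_ternary_shift h_cont]) auto
    then show "continuous_on UNIV T"
      unfolding T_def[abs_def] using h_in ternary_shift_cantor_set
      by (intro continuous_on_compose2[OF k_cont]) auto
    have h_lim: "(h \<longlongrightarrow> h x) (nhds x)" for x
      using h_cont by (simp add: continuous_on_eq_continuous_at isCont_def tendsto_at_iff_tendsto_nhds)
    show "locally_constant b"
      unfolding locally_constant_def
    proof
      fix x
      show "\<forall>\<^sub>F y in nhds x. b y = b x"
      proof (cases "h x < 1 / 2")
        case True
        then show ?thesis
          using order_tendstoD(2)[OF h_lim True] by (auto simp: b_def elim: eventually_mono)
      next
        case False
        then have "1 / 2 < h x" using cantor_set_gap[OF h_in[of x]] by auto
        from order_tendstoD(1)[OF h_lim this] show ?thesis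
          using False by (auto simp: b_def elim: eventually_mono)
      qed
    qed
    show "0 \<le> h x \<and> h x \<le> 1" for x using cantor_set_bounds[OF h_in] .
    show "\<bar>h x - h y\<bar> = \<bar>h (T x) - h (T y)\<bar> / 3" if "b x = b y" for x y
      using that unfolding hT b_def ternary_shift_def by (auto simp: abs_if)
    show "\<exists>x. b x = \<beta> \<and> T x = z" for \<beta> z
    proof (intro exI conjI)
      \<comment> \<open>\<open>w\<close> is \<open>h z\<close> with the digit prescribed by
        \<open>\<beta>\<close> put in front.\<close>
      define w where "w = (if \<beta> then h z / 3 else 2 / 3 + h z / 3)"
      have "w \<in> cantor_set" unfolding w_def using cantor_set_branches[OF h_in] by simp
      then have "h (k w) = w" by (rule hk_inv)
      moreover have "0 \<le> h z" "h z \<le> 1" using cantor_set_bounds[OF h_in] by auto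
      ultimately show "b (k w) = \<beta>" "T (k w) = z"
        unfolding b_def T_def ternary_shift_def by (auto simp: w_def kh)
    qed
    show "\<exists>d>0. \<forall>x y. \<bar>h x - h y\<bar> < d \<longrightarrow> dist x y < e" if "e > 0" for e
    proof -
      have "uniformly_continuous_on cantor_set k"
        using compact_uniformly_continuous[OF k_cont compact_cantor_set] .
      then obtain d where "d > 0"
        "\<And>u v. \<lbrakk>u \<in> cantor_set; v \<in> cantor_set; dist u v < d\<rbrakk> \<Longrightarrow> dist (k u) (k v) < e"
        using \<open>e > 0\<close> unfolding uniformly_continuous_on_def by metis
      then show ?thesis using h_in kh by (metis dist_real_def)
    qed
  qed
qed

text \<open>The first \<open>n\<close> digits determine \<open>h\<close> up to
  \<open>(1 / 3) ^ n\<close>, which gives fine codes. Fixing them leaves the remaining digits free,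
  so \<open>T ^^ n\<close> maps each such cylinder onto the space.\<close>

lemma cantor_space_properties:
  assumes "(UNIV :: 'a::metric_space set) homeomorphic cantor_set"
  obtains T :: "'a::metric_space \<Rightarrow> 'a" and b :: "'a::metric_space \<Rightarrow> bool" where
    "has_fine_codes TYPE('a)" "continuous_on UNIV T" "surj T" "locally_eventually_onto T"
    "locally_constant b" "surj b"
proof -
  obtain T :: "'a \<Rightarrow> 'a" and b :: "'a \<Rightarrow> bool" and h :: "'a \<Rightarrow> real" where
    T: "continuous_on UNIV T" and b: "locally_constant b"
    and h01: "\<And>x. 0 \<le> h x \<and> h x \<le> 1"
    and expand: "\<And>x y. b x = b y \<Longrightarrow> \<bar>h x - h y\<bar> = \<bar>h (T x) - h (T y)\<bar> / 3"
    and onto: "\<And>\<beta> z. \<exists>x. b x = \<beta> \<and> T x = z"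
    and unif: "\<And>e. e > 0 \<Longrightarrow> \<exists>d>0. \<forall>x y. \<bar>h x - h y\<bar> < d \<longrightarrow> dist x y < e"
  proof (rule cantor_space_structure[OF assms], goal_cases)
    case (1 T b h)
    show ?thesis by (rule that[of T b h]) (fact 1)+
  qed
  have small: "\<exists>n. \<forall>x y. \<bar>h x - h y\<bar> \<le> (1 / 3) ^ n \<longrightarrow> dist x y < e" if e: "e > 0" for e
  proof -
    obtain d where d: "d > 0" "\<And>x y. \<bar>h x - h y\<bar> < d \<Longrightarrow> dist x y < e"
      using unif[OF e] by blast
    obtain n where "(1 / 3) ^ n < d" using real_arch_pow_inv[OF d(1), of "1 / 3"] by auto
    then show ?thesis using d(2) by (meson le_less_trans)
  qed
  have code: "\<exists>c :: 'a \<Rightarrow> nat. locally_constant c \<and> (\<forall>u v. c u = c v \<longrightarrow> \<bar>h u - h v\<bar> \<le> (1 / 3) ^ n)" for n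
  proof (induction n)
    case 0
    have "\<bar>h u - h v\<bar> \<le> 1" for u v using h01[of u] h01[of v] by auto
    then show ?case by (intro exI[of _ "\<lambda>_. 0"]) (simp add: locally_constant_def)
  next
    case (Suc n)
    then obtain c :: "'a \<Rightarrow> nat" where c: "locally_constant c"
      "\<And>u v. c u = c v \<Longrightarrow> \<bar>h u - h v\<bar> \<le> (1 / 3) ^ n" by blast
    \<comment> \<open>The parity of \<open>c' x\<close> stores the digit of \<open>x\<close>, and
      \<open>c' x div 2\<close> the code of \<open>T x\<close>.\<close>
    define c' where "c' x = 2 * c (T x) + of_bool (b x)" for x
    have "locally_constant c'"
      using locally_constant_map[OF locally_constant_Pair[OF locally_constant_compose[OF c(1) T] b],
          of "\<lambda>(v, \<beta>). 2 * v + of_bool \<beta>"] by (simp add: c'_def[abs_def])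
    moreover have "\<bar>h u - h v\<bar> \<le> (1 / 3) ^ Suc n" if "c' u = c' v" for u v
    proof -
      have "b u = b v" "c (T u) = c (T v)"
        using that unfolding c'_def by (cases "b u"; cases "b v"; simp; presburger)+
      then show ?thesis using expand[of u v] c(2)[of "T u" "T v"] by simp
    qed
    ultimately show ?case by blast
  qed
  have "has_fine_codes TYPE('a)"
    unfolding has_fine_codes_def using code small by meson
  moreover have "surj T" "surj b" using onto unfolding surj_def by metis+
  moreover have "locally_eventually_onto T"
    unfolding locally_eventually_onto_def
  proof (intro allI impI, elim conjE)
    fix U :: "'a set" assume "open U" "U \<noteq> {}"
    then obtain x e where e: "e > 0" "ball x e \<subseteq> U" by (meson ex_in_conv open_contains_ball)
    obtain n where n: "\<And>x y. \<bar>h x - h y\<bar> \<le> (1 / 3) ^ n \<Longrightarrow> dist x y < e" using small[OF e(1)] by blast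
    \<comment> \<open>\<open>y\<close> takes its first \<open>n\<close> digits from \<open>x\<close>
      and the rest from \<open>z\<close>; each induction step puts the first digit of
      \<open>x\<close> in front.\<close>
    have "\<exists>y. (T ^^ n) y = z \<and> \<bar>h x - h y\<bar> \<le> (1 / 3) ^ n" for x z n
    proof (induction n arbitrary: x)
      case 0
      then show ?case using h01[of x] h01[of z] by auto
    next
      case (Suc n)
      obtain w where w: "(T ^^ n) w = z" "\<bar>h (T x) - h w\<bar> \<le> (1 / 3) ^ n" using Suc by blast
      obtain y where y: "b y = b x" "T y = w" using onto by blast
      then show ?case using w expand[of x y] by (intro exI[of _ y]) (simp add: funpow_Suc_right del: funpow.simps)
    qed
    then have "z \<in> (T ^^ n) ` U" for z using n e(2) by (metis image_eqI mem_ball subsetD)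
    then show "\<exists>n. (T ^^ n) ` U = UNIV" by blast
  qed
  ultimately show ?thesis using that T b by blast
qed

theorem lemma1:
  assumes cantor: "(UNIV :: 'a::metric_space set) homeomorphic cantor_set"
  shows "residual_in (cont_maps_topology :: ('a \<Rightarrow> 'a) topology)
           {f \<in> cont_maps. \<not> DC1 (\<lambda>_. f) \<and> \<not> DC2 (\<lambda>_. f) \<and> \<not> DC3 (\<lambda>_. f)}
       \<and> residual_in (conv_systems_topology :: (nat \<Rightarrow> 'a \<Rightarrow> 'a) topology)
           {F \<in> conv_systems. \<not> DC1 F \<and> \<not> DC2 F \<and> \<not> DC3 F}"
proof -
  have compact: "compact (UNIV :: 'a set)"
    using cantor compact_cantor_set homeomorphic_compactness by blast
  have bdd: "bounded (UNIV :: 'a set)" by (rule compact_imp_bounded[OF compact])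
  obtain T :: "'a \<Rightarrow> 'a" and b :: "'a \<Rightarrow> bool" where codes: "has_fine_codes TYPE('a)"
    and T: "continuous_on UNIV T" "surj T" "locally_eventually_onto T"
    and b: "locally_constant b" "surj b"
    using cantor_space_properties[OF cantor] by metis
  \<comment> \<open>The mesh bounds \<open>1 / real (Suc k)\<close> suffice, which leaves countably
    many conditions for the residual criterion.\<close>
  have not_chaotic: "\<not> DC1 F \<and> \<not> DC2 F \<and> \<not> DC3 F"
    if coded: "\<And>k. finitely_coded (1 / real (Suc k)) F" for F :: "nat \<Rightarrow> 'a \<Rightarrow> 'a"
  proof (rule finitely_coded_not_chaotic)
    fix e :: real assume "e > 0"
    then obtain k where "1 / real (Suc k) < e" using nat_approx_posE by blast
    then show "finitely_coded e F"
      using coded[of k] unfolding finitely_coded_def by (meson less_trans)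
  qed
  interpret A: Metric_space "cont_maps :: ('a \<Rightarrow> 'a) set" rho_sup
    by (rule Metric_space_rho_sup[OF bdd])
  interpret N: Metric_space "conv_systems :: (nat \<Rightarrow> 'a \<Rightarrow> 'a) set" rho_F
    by (rule Metric_space_rho_F[OF bdd])
  have "residual_in A.mtopology {f \<in> cont_maps. \<not> DC1 (\<lambda>_. f) \<and> \<not> DC2 (\<lambda>_. f) \<and> \<not> DC3 (\<lambda>_. f)}"
  proof (rule A.residual_in_mtopology[where P = "\<lambda>k f. finitely_coded (1 / real (Suc k)) (\<lambda>_. f)"])
    fix k and f :: "'a \<Rightarrow> 'a" and e :: real
    assume f: "f \<in> cont_maps" and e: "e > 0"
    obtain g r where "continuous_on UNIV g" "rho_sup f g < e" "r > 0"
      "\<And>h. rho_sup g h < r \<Longrightarrow> finitely_coded (1 / real (Suc k)) (\<lambda>_. h)"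
      using autonomous_dense[OF compact codes _ e, of f "1 / real (Suc k)"] f
      unfolding cont_maps_def by auto
    then show "\<exists>g\<in>cont_maps. rho_sup f g < e \<and>
        (\<exists>r>0. \<forall>h\<in>cont_maps. rho_sup g h < r \<longrightarrow> finitely_coded (1 / real (Suc k)) (\<lambda>_. h))"
      unfolding cont_maps_def by blast
  next
    fix f :: "'a \<Rightarrow> 'a"
    assume "f \<in> cont_maps" "\<And>k. finitely_coded (1 / real (Suc k)) (\<lambda>_. f)"
    with not_chaotic[of "\<lambda>_. f"]
    show "f \<in> {f \<in> cont_maps. \<not> DC1 (\<lambda>_. f) \<and> \<not> DC2 (\<lambda>_. f) \<and> \<not> DC3 (\<lambda>_. f)}"
      by blast
  qed blast
  moreover have "residual_in N.mtopology {F \<in> conv_systems. \<not> DC1 F \<and> \<not> DC2 F \<and> \<not> DC3 F}"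
  proof (rule N.residual_in_mtopology[where P = "\<lambda>k. finitely_coded (1 / real (Suc k))"])
    fix k and F :: "nat \<Rightarrow> 'a \<Rightarrow> 'a" and e :: real
    assume F: "F \<in> conv_systems" and e: "e > 0"
    obtain G r where "G \<in> conv_systems" "rho_F F G < e" "r > 0"
      "\<And>H. rho_F G H < r \<Longrightarrow> finitely_coded (1 / real (Suc k)) H"
      using nonautonomous_dense[OF compact codes T b F e, of "1 / real (Suc k)"] by auto
    then show "\<exists>G\<in>conv_systems. rho_F F G < e \<and>
        (\<exists>r>0. \<forall>H\<in>conv_systems. rho_F G H < r \<longrightarrow> finitely_coded (1 / real (Suc k)) H)"
      by blast
  next
    fix F :: "nat \<Rightarrow> 'a \<Rightarrow> 'a"
    assume "F \<in> conv_systems" "\<And>k. finitely_coded (1 / real (Suc k)) F"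
    with not_chaotic[of F] show "F \<in> {F \<in> conv_systems. \<not> DC1 F \<and> \<not> DC2 F \<and> \<not> DC3 F}"
      by blast
  qed blast
  ultimately show ?thesis unfolding cont_maps_topology_def conv_systems_topology_def by blast
qed

end
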